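(* Let $n\geq 1$ be an integer, let $\mathbb{F}_q$ be a finite field with $q$ elements, and let $\mathcal{F}_q\subseteq GL_n(\mathbb{F}_q)$ be an intersecting set. Then $$|\mathcal{F}_q|\leq q^{(n-1)n/2}\prod_{i=1}^{n-1}(q^i-1).$$
   Context: $\mathbb{F}_q^n$ is the $n$-dimensional row vector space over $\mathbb{F}_q$, and $GL_n(\mathbb{F}_q)$ is the group of $n\times n$ nonsingular matrices over $\mathbb{F}_q$, acting on $\mathbb{F}_q^n$ by right multiplication $(\alpha,T)\mapsto \alpha T$. A set $\mathcal{F}_q\subseteq GL_n(\mathbb{F}_q)$ is called intersecting if for any $T,S\in\mathcal{F}_q$ there exists a non-zero vector $\alpha\in\mathbb{F}_q^n$ such that $\alpha T=\alpha S$. (An empty product equals $1$.) *)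

theory Defs
  imports "HOL-Analysis.Cartesian_Space"
begin

definition GL :: "('a::field ^ 'n ^ 'n) set" where
  "GL = {T. invertible T}"

text \<open>Matrices act on row vectors from the right: \<open>\<alpha> v* T\<close> is the row vector \<open>\<alpha>T\<close>.\<close>

definition intersecting :: "('a::field ^ 'n ^ 'n) set \<Rightarrow> bool" where
  "intersecting \<F> \<longleftrightarrow>
     (\<forall>T\<in>\<F>. \<forall>S\<in>\<F>. \<exists>\<alpha> :: 'a ^ 'n. \<alpha> \<noteq> 0 \<and> \<alpha> v* T = \<alpha> v* S)"

end

theory Submission
  imports Defs "HOL-Algebra.Algebraic_Closure_Type" "HOL-Number_Theory.Residues"
begin

text \<open>Multiplication by the nonzero elements of the extension field of degree \<open>n\<close>, identified with the row
  space as a vector space, gives \<open>q\<^sup>n - 1\<close> invertible matrices, no two of which agree on a nonzero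
  vector. If \<open>T\<close> and \<open>T'\<close> agree on a nonzero vector and \<open>TA = T'A'\<close> for two of these matrices, then
  \<open>A\<close> and \<open>A'\<close> agree on a nonzero vector, so \<open>A = A'\<close> and \<open>T = T'\<close>. Hence an intersecting set has at
  most \<open>\<bar>GL\<bar> / (q\<^sup>n - 1)\<close> elements.\<close>

unbundle no fps_syntax

section \<open>The Frobenius map on a finite field and on its algebraic closure\<close>

text \<open>Multiplication by a nonzero \<open>a\<close> permutes the nonzero elements; comparing
  their products gives \<open>a ^ (CARD('a) - 1) = 1\<close>.\<close>

lemma power_CARD_eq_self:
  fixes a :: "'a::{field,finite}"
  shows "a ^ CARD('a) = a"
proof (cases "a = 0")
  case False
  have "(\<Prod>y\<in>UNIV-{0}. a * y) = (\<Prod>y\<in>UNIV-{0}. y)"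
    by (rule prod.reindex_bij_witness[of _ "\<lambda>y. y / a" "\<lambda>y. a * y"]) (use False in auto)
  then have "a ^ (CARD('a) - 1) = 1"
    by (simp add: prod.distrib)
  then show ?thesis
    using power_minus_mult[of "CARD('a)" a] by simp
qed (simp add: zero_power)

lemma of_nat_CARD_eq_0: "of_nat CARD('a) = (0 :: 'a::{field,finite})"
  using CHAR_dvd_CARD[where 'a='a] by (simp add: of_nat_eq_0_iff_char_dvd)

text \<open>The polynomials \<open>(X + 1)\<^sup>q\<close> and \<open>X\<^sup>q + 1\<close> are monic of degree \<open>q\<close> and agree on the \<open>q\<close> elements
  of the base field, so they are equal; no prime factorisation of \<open>q\<close> is needed.\<close>

lemma power_CARD_add:
  fixes x y :: "'a::{field,finite} alg_closure"
  shows "(x + y) ^ CARD('a) = x ^ CARD('a) + y ^ CARD('a)"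
proof (cases "x = 0")
  case False
  define q where "q = CARD('a)"
  have "q > 0" by (simp add: q_def)
  have eq: "[:1, 1 :: 'a alg_closure:] ^ q = monom 1 q + 1"
  proof (rule poly_eqI_degree_lead_coeff[where n = q and A = "range to_ac"])
    have *: "degree ([:1, 1 :: 'a alg_closure:] ^ q) = q" 
      by (simp add: degree_power_eq)
    then show "degree ([:1, 1 :: 'a alg_closure:] ^ q) \<le> q" by simp
    have "lead_coeff ([:1, 1 :: 'a alg_closure:] ^ q) = 1"
      unfolding lead_coeff_power by simp
    then show "coeff ([:1, 1 :: 'a alg_closure:] ^ q) q = coeff (monom 1 q + 1) q"
      using * \<open>q > 0\<close> by (simp add: coeff_1)
    show "q \<le> card (range (to_ac :: 'a \<Rightarrow> _))"
      by (simp add: card_image inj_to_ac q_def)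
    show "degree (monom 1 q + 1 :: 'a alg_closure poly) \<le> q"
      by (intro degree_add_le) (simp_all add: degree_monom_le)
    show "poly ([:1, 1:] ^ q) z = poly (monom 1 q + 1) z" if "z \<in> range (to_ac :: 'a \<Rightarrow> _)" for z
    proof -
      from that obtain a :: 'a where z: "z = to_ac a" by blast
      have "poly ([:1, 1:] ^ q) z = to_ac ((1 + a) ^ q)"
        by (simp add: z poly_power)
      also have "\<dots> = to_ac (a ^ q) + 1"
        by (simp add: power_CARD_eq_self q_def flip: to_ac_power)
      finally show ?thesis by (simp add: z poly_monom)
    qed
  qed
  \<comment> \<open>Evaluating at \<open>y / x\<close> and multiplying by \<open>x ^ q\<close>
    homogenises the identity; hence the separate case \<open>x = 0\<close>.\<close>
  have "(1 + y / x) ^ q = poly ([:1, 1:] ^ q) (y / x)"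
    by (simp add: poly_power)
  also have "\<dots> = 1 + (y / x) ^ q"
    unfolding eq by (simp add: poly_monom)
  finally have "x ^ q * (1 + y / x) ^ q = x ^ q * (1 + (y / x) ^ q)"
    by simp
  then show ?thesis
    using False by (simp add: distrib_left flip: q_def power_mult_distrib)
qed (simp add: zero_power)

lemma power_CARD_power_add:
  fixes x y :: "'a::{field,finite} alg_closure"
  shows "(x + y) ^ (CARD('a) ^ k) = x ^ (CARD('a) ^ k) + y ^ (CARD('a) ^ k)"
  by (induction k) (simp_all add: power_mult power_CARD_add power_Suc2 del: power_Suc)

lemma to_ac_power_CARD_power:
  fixes a :: "'a::{field,finite}"
  shows "to_ac a ^ (CARD('a) ^ k) = to_ac a"
  by (induction k) (simp_all add: power_mult power_CARD_eq_self power_Suc2 del: power_Suc flip: to_ac_power)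

section \<open>Simple roots and the finite extension fields\<close>

text \<open>The polynomial splits into linear factors, and a repeated factor would give a common
  root of \<open>p\<close> and \<open>pderiv p\<close>. So the multiset of roots has no
  repetitions.\<close>

lemma card_roots_eq_degree:
  fixes p :: "'a::alg_closed_field poly"
  assumes "p \<noteq> 0" and simple: "\<And>x. poly p x = 0 \<Longrightarrow> poly (pderiv p) x \<noteq> 0"
  shows "card {x. poly p x = 0} = degree p"
proof -
  obtain A where A: "size A = degree p" "p = smult (lead_coeff p) (\<Prod>x\<in>#A. [:-x, 1:])"
    using alg_closed_imp_factorization[OF \<open>p \<noteq> 0\<close>] by blast
  have "poly p x = lead_coeff p * (\<Prod>a\<in>#A. x - a)" for x
    by (subst A(2)) (simp add: poly_prod_mset)
  then have roots: "{x. poly p x = 0} = set_mset A"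
    using \<open>p \<noteq> 0\<close> by (auto simp: prod_mset_zero_iff)
  have "count A x = 1" if x: "x \<in># A" for x
  proof (rule ccontr)
    obtain B where B: "A = add_mset x B"
      using x by (metis insert_DiffM)
    assume "count A x \<noteq> 1"
    then have "x \<in># B"
      by (simp add: B not_in_iff)
    then obtain C where C: "B = add_mset x C"
      by (metis insert_DiffM)
    define r where "r = smult (lead_coeff p) (\<Prod>x\<in>#C. [:-x, 1:])"
    have linear_root: "poly [:-x, 1:] x = 0" by simp
    have "p = [:-x, 1:] * ([:-x, 1:] * r)"
      by (subst A(2)) (simp add: B C r_def)
    then have "poly p x = 0" "poly (pderiv p) x = 0"
      by (simp_all only: pderiv_mult poly_add poly_mult linear_root mult_zero_left add_0)
    with simple show False by blast
  qed
  then show ?thesis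
    unfolding roots A(1)[symmetric] by (simp add: size_multiset_overloaded_eq)
qed

text \<open>For \<open>k > 0\<close> this is the extension of degree \<open>k\<close> inside the
  closure. Taking the fixed points of an iterated Frobenius map avoids choosing an irreducible
  polynomial.\<close>

definition galois_subfield :: "nat \<Rightarrow> 'a::{field,finite} alg_closure set" where
  "galois_subfield k = {x. x ^ (CARD('a) ^ k) = x}"

text \<open>The elements are the roots of \<open>X^N - X\<close> with
  \<open>N = CARD('a) ^ k\<close>. Since \<open>k > 0\<close>, \<open>N\<close> vanishes in the
  field, so the derivative is \<open>-1\<close> and every root is simple.\<close>

lemma card_galois_subfield:
  assumes "k > 0"
  shows "card (galois_subfield k :: 'a::{field,finite} alg_closure set) = CARD('a) ^ k"
proof -
  define N where "N = CARD('a) ^ k"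
  define p :: "'a alg_closure poly" where "p = monom 1 N - monom 1 1"
  have "2 \<le> CARD('a)"
    using card_mono[of UNIV "{0, 1 :: 'a}"] by simp
  with assms have N: "N > 1"
    unfolding N_def by (metis one_less_power less_eq_Suc_le Suc_1)
  have "of_nat N = (0 :: 'a alg_closure)"
    using assms of_nat_CARD_eq_0[where 'a='a]
    by (metis N_def of_nat_power to_ac_0 to_ac_of_nat zero_power)
  then have pderiv: "pderiv p = -1"
    by (simp add: p_def pderiv_diff pderiv_monom monom_0 flip: pCons_one)
  have "degree p = N"
    unfolding p_def diff_conv_add_uminus using N
    by (subst degree_add_eq_left) (simp_all add: degree_monom_eq)
  moreover have "card {x. poly p x = 0} = degree p"
    using pderiv by (intro card_roots_eq_degree) auto
  moreover have "{x. poly p x = 0} = galois_subfield k"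
    by (simp add: p_def poly_monom galois_subfield_def N_def)
  ultimately show ?thesis by (simp add: N_def)
qed

lemma galois_subfield_mult:
  "x \<in> galois_subfield k \<Longrightarrow> y \<in> galois_subfield k \<Longrightarrow> x * y \<in> galois_subfield k"
  by (simp add: galois_subfield_def power_mult_distrib)

interpretation ac: vector_space "\<lambda>(a :: 'a::field) x. to_ac a * x"
  by unfold_locales (simp_all add: algebra_simps)

text \<open>The iterated Frobenius map is additive and fixes the embedded base field, so it is
  linear over it, and its fixed points form a subspace.\<close>

lemma subspace_galois_subfield: "ac.subspace (galois_subfield k :: 'a::{field,finite} alg_closure set)"
  by (intro ac.subspaceI)
     (simp_all add: galois_subfield_def power_CARD_power_add power_mult_distrib to_ac_power_CARD_power zero_power)

section \<open>Counting spans and independent lists\<close>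

context vector_space
begin

text \<open>Coefficient functions are extensional because the sum cannot see their values outside
  \<open>B\<close>.\<close>

lemma inj_on_sum_scale:
  assumes "finite B" "independent B"
  shows "inj_on (\<lambda>u. \<Sum>b\<in>B. scale (u b) b) (B \<rightarrow>\<^sub>E UNIV)"
proof (rule inj_onI)
  fix u v assume uv: "u \<in> B \<rightarrow>\<^sub>E UNIV" "v \<in> B \<rightarrow>\<^sub>E UNIV"
    and "(\<Sum>b\<in>B. scale (u b) b) = (\<Sum>b\<in>B. scale (v b) b)"
  then have "(\<Sum>b\<in>B. scale (u b - v b) b) = 0"
    by (simp add: scale_left_diff_distrib sum_subtractf)
  then have "u b - v b = 0" if "b \<in> B" for b
    using independentD[OF assms(2,1) order_refl, of "\<lambda>b. u b - v b"] that by blast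
  then show "u = v"
    by (intro PiE_ext[OF uv]) simp
qed

lemma card_span:
  assumes "finite B" "independent B"
  shows "card (span B) = card (UNIV :: 'a set) ^ card B"
proof -
  have "span B = (\<lambda>u. \<Sum>b\<in>B. scale (u b) b) ` (B \<rightarrow>\<^sub>E UNIV)"
    unfolding span_finite[OF assms(1)]
    by (auto intro!: image_eqI[where x = "restrict u B" for u] sum.cong)
  then show ?thesis
    using assms by (simp add: card_image inj_on_sum_scale card_funcsetE)
qed

text \<open>An independent list of length \<open>i\<close> is extended by any vector outside its
  span, and \<open>card_span\<close> counts that span.\<close>

lemma card_independent_lists:
  assumes "finite (UNIV :: 'b set)"
  shows "card {xs. length xs = k \<and> distinct xs \<and> independent (set xs)}
    = (\<Prod>i<k. card (UNIV :: 'b set) - card (UNIV :: 'a set) ^ i)"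
proof (induction k)
  case 0
  have "{xs :: 'b list. length xs = 0 \<and> distinct xs \<and> independent (set xs)} = {[]}"
    using independent_empty by auto
  then show ?case by simp
next
  case (Suc k)
  define L where "L k = {xs :: 'b list. length xs = k \<and> distinct xs \<and> independent (set xs)}" for k
  have "L (Suc k) = (\<lambda>(xs, x). x # xs) ` (SIGMA xs : L k. - span (set xs))"
  proof (intro equalityI subsetI)
    fix ys assume ys: "ys \<in> L (Suc k)"
    then obtain x xs where [simp]: "ys = x # xs"
      by (auto simp: L_def length_Suc_conv)
    have "xs \<in> L k" "x \<in> - span (set xs)"
      using ys by (auto simp: L_def independent_insert)
    then show "ys \<in> (\<lambda>(xs, x). x # xs) ` (SIGMA xs : L k. - span (set xs))"
      by (intro image_eqI[where x = "(xs, x)"]) auto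
  qed (auto simp: L_def independent_insertI dest: span_base)
  moreover have "inj_on (\<lambda>(xs, x). x # xs) (SIGMA xs : L k. - span (set xs))"
    by (auto simp: inj_on_def)
  moreover have "finite (L k)"
    by (rule finite_subset[OF _ finite_lists_length_eq[OF assms, of k]]) (auto simp: L_def)
  ultimately have "card (L (Suc k)) = (\<Sum>xs\<in>L k. card (- span (set xs)))"
    using finite_subset[OF subset_UNIV assms] by (simp add: card_image card_SigmaI)
  also have "\<dots> = (\<Sum>xs\<in>L k. card (UNIV :: 'b set) - card (UNIV :: 'a set) ^ k)"
    using finite_subset[OF subset_UNIV assms]
    by (intro sum.cong) (auto simp: L_def card_span distinct_card Compl_eq_Diff_UNIV card_Diff_subset)
  finally show ?case
    using Suc by (simp add: L_def)
qed

end

section \<open>The order of the general linear group\<close>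

text \<open>Listing the rows in a fixed order maps invertible matrices injectively to independent
  lists of length \<open>CARD('n)\<close>.\<close>

lemma card_GL_le:
  "card (GL :: ('a::{field,finite} ^ 'n ^ 'n) set) \<le> (\<Prod>i<CARD('n). CARD('a) ^ CARD('n) - CARD('a) ^ i)"
proof -
  obtain es :: "'n list" where es: "set es = UNIV" "distinct es"
    using finite_distinct_list[OF finite] by blast
  have len: "length es = CARD('n)"
    using distinct_card[OF es(2)] es(1) by simp
  define f :: "'a ^ 'n ^ 'n \<Rightarrow> ('a ^ 'n) list" where "f A = map (\<lambda>i. A $ i) es" for A
  have "inj f"
    using es(1) by (auto simp: inj_def f_def vec_eq_iff)
  have "f A \<in> {xs. length xs = CARD('n) \<and> distinct xs \<and> vec.independent (set xs)}"
    if "A \<in> GL" for A :: "'a ^ 'n ^ 'n"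
  proof -
    have rows: "c i = 0" if "(\<Sum>i\<in>UNIV. c i *s A $ i) = 0" for c i
      using \<open>A \<in> GL\<close> that matrix_right_invertible_independent_rows[of A]
      unfolding GL_def invertible_right_inverse by (simp add: row_def)
    \<comment> \<open>Independence of the set of rows cannot detect repetitions, so distinctness is
      shown separately: two equal rows would satisfy a relation with coefficients 1 and -1.\<close>
    have inj: "inj (\<lambda>i. A $ i)"
    proof (rule injI, rule ccontr)
      fix i j assume ij: "A $ i = A $ j" "i \<noteq> j"
      have "(\<Sum>k\<in>UNIV. (if k = i then 1 else if k = j then -1 else 0) *s A $ k)
          = (\<Sum>k\<in>{i, j}. (if k = i then 1 else if k = j then -1 else 0) *s A $ k)"
        by (rule sum.mono_neutral_right) auto
      also have "\<dots> = 0" using ij by simp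
      finally show False
        using rows[of "\<lambda>k. if k = i then 1 else if k = j then -1 else 0" i] by simp
    qed
    have "vec.independent (range (\<lambda>i. A $ i))"
      by (rule vec.independent_if_scalars_zero)
         (auto simp: sum.reindex[OF inj] intro: rows)
    then show ?thesis
      using inj es by (simp add: f_def len distinct_map inj_on_subset)
  qed
  then have "card (GL :: ('a ^ 'n ^ 'n) set) \<le> card {xs :: ('a ^ 'n) list. length xs = CARD('n) \<and> distinct xs \<and> vec.independent (set xs)}"
    using \<open>inj f\<close> finite_lists_length_eq[of "UNIV :: ('a ^ 'n) set" "CARD('n)"]
    by (intro card_inj_on_le[where f = f]) (auto intro: inj_on_subset elim!: finite_subset[rotated])
  then show ?thesis
    by (simp add: vec.card_independent_lists)
qed


section \<open>The extension field in coordinates and its multiplication matrices\<close>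

text \<open>A maximal independent subset is a basis, and comparing cardinalities shows that it has
  \<open>CARD('n)\<close> elements, so the matrix index type can index it.\<close>

lemma galois_subfield_coordinates:
  obtains b :: "'n::finite \<Rightarrow> 'a::{field,finite} alg_closure"
  where "bij_betw (\<lambda>v :: 'a ^ 'n. \<Sum>i\<in>UNIV. to_ac (v $ i) * b i) UNIV (galois_subfield CARD('n))"
proof -
  let ?K = "galois_subfield CARD('n) :: 'a alg_closure set"
  have card_K: "card ?K = CARD('a) ^ CARD('n)"
    by (rule card_galois_subfield) simp
  then have "finite ?K"
    by (metis card.infinite power_not_zero zero_less_card_finite less_irrefl)
  obtain B where B: "B \<subseteq> ?K" "ac.independent B" "?K \<subseteq> ac.span B"
    using ac.maximal_independent_subset .
  then have span: "ac.span B = ?K"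
    using ac.span_subspace subspace_galois_subfield by blast
  have "finite B"
    using B(1) \<open>finite ?K\<close> by (rule finite_subset)
  \<comment> \<open>With base at least 2, equal powers have equal exponents.\<close>
  have "2 \<le> CARD('a)"
    using card_mono[of UNIV "{0, 1 :: 'a}"] by simp
  then have "card B = CARD('n)"
    using ac.card_span[OF \<open>finite B\<close> B(2)] by (simp add: span card_K)
  then obtain b :: "'n \<Rightarrow> 'a alg_closure" where b: "bij_betw b UNIV B"
    using \<open>finite B\<close> finite_same_card_bij[of "UNIV :: 'n set" B] by auto
  let ?\<phi> = "\<lambda>v :: 'a ^ 'n. \<Sum>i\<in>UNIV. to_ac (v $ i) * b i"
  have "inj ?\<phi>"
  proof (rule injI)
    fix v w assume "?\<phi> v = ?\<phi> w"
    then have "(\<Sum>i\<in>UNIV. to_ac (v $ i - w $ i) * b i) = 0"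
      by (simp add: left_diff_distrib sum_subtractf)
    \<comment> \<open>The sum is moved from the index type to \<open>B\<close>, where independence
      is stated.\<close>
    also have "(\<Sum>i\<in>UNIV. to_ac (v $ i - w $ i) * b i)
        = (\<Sum>x\<in>B. to_ac (v $ inv_into UNIV b x - w $ inv_into UNIV b x) * x)"
      using b sum.reindex_bij_betw[OF b, of "\<lambda>x. to_ac (v $ inv_into UNIV b x - w $ inv_into UNIV b x) * x"]
      by (simp add: bij_betw_def)
    finally have "v $ inv_into UNIV b x - w $ inv_into UNIV b x = 0" if "x \<in> B" for x
      using ac.independentD[OF B(2) \<open>finite B\<close> order_refl, of "\<lambda>x. v $ inv_into UNIV b x - w $ inv_into UNIV b x"] that
      by blast
    from this[of "b _"] show "v = w"
      using b by (auto simp: bij_betw_def vec_eq_iff)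
  qed
  moreover have "range ?\<phi> \<subseteq> ?K"
    using b B(1) subspace_galois_subfield
    by (auto intro!: ac.subspace_sum ac.subspace_scale simp: bij_betw_def)
  moreover have "card (range ?\<phi>) = card ?K"
    using \<open>inj ?\<phi>\<close> by (simp add: card_image card_K)
  ultimately have "bij_betw ?\<phi> UNIV ?K"
    using \<open>finite ?K\<close> by (simp add: bij_betw_def card_subset_eq)
  then show thesis by (rule that)
qed

text \<open>The kernel criterion for column vectors is applied to the transpose.\<close>

lemma invertible_if_trivial_left_kernel:
  fixes A :: "'a::field ^ 'n ^ 'n"
  assumes "\<And>v. v v* A = 0 \<Longrightarrow> v = 0"
  shows "invertible A"
  using assms unfolding invertible_right_inverse
  by (simp flip: left_invertible_transpose add: matrix_left_invertible_ker)

text \<open>The set constructed here is a Singer cycle.\<close>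

lemma exists_semiregular_matrices:
  obtains S :: "('a::{field,finite} ^ 'n ^ 'n) set"
  where "S \<subseteq> GL" "card S = CARD('a) ^ CARD('n) - 1"
    "\<And>A B v. A \<in> S \<Longrightarrow> B \<in> S \<Longrightarrow> v \<noteq> 0 \<Longrightarrow> v v* A = v v* B \<Longrightarrow> A = B"
proof -
  let ?K = "galois_subfield CARD('n) :: 'a alg_closure set"
  obtain b :: "'n \<Rightarrow> 'a alg_closure"
    where b: "bij_betw (\<lambda>v :: 'a ^ 'n. \<Sum>i\<in>UNIV. to_ac (v $ i) * b i) UNIV ?K"
    using galois_subfield_coordinates .
  define \<phi> where "\<phi> = (\<lambda>v :: 'a ^ 'n. \<Sum>i\<in>UNIV. to_ac (v $ i) * b i)"
  have bij: "bij_betw \<phi> UNIV ?K" using b by (simp add: \<phi>_def)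
  then have \<phi>_eq: "\<phi> v = \<phi> w \<longleftrightarrow> v = w" for v w
    by (auto simp: bij_betw_def dest: injD)
  have \<phi>_0: "\<phi> 0 = 0" by (simp add: \<phi>_def)
  have \<phi>_axis: "\<phi> (axis i 1) = b i" for i
  proof -
    have "\<phi> (axis i 1) = (\<Sum>j\<in>UNIV. if j = i then b j else 0)"
      unfolding \<phi>_def by (intro sum.cong) (auto simp: axis_def)
    then show ?thesis by simp
  qed
  \<comment> \<open>Row \<open>i\<close> holds the coordinates of \<open>b i * x\<close>, so
    \<open>M x\<close> represents multiplication by \<open>x\<close>. For \<open>x\<close> in the
    subfield, closure under products puts \<open>b i * x\<close> in the range of
    \<open>\<phi>\<close>, making \<open>inv_into\<close> a genuine preimage.\<close>
  define M where "M x = (\<chi> i. inv_into UNIV \<phi> (b i * x))" for x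
  have \<phi>_M: "\<phi> (v v* M x) = \<phi> v * x" if "x \<in> ?K" for v x
  proof -
    have "b i * x \<in> range \<phi>" for i
      using bij \<phi>_axis[of i] galois_subfield_mult[OF _ that, of "b i"]
      by (metis bij_betw_def rangeI)
    then have rows: "(\<Sum>j\<in>UNIV. to_ac (M x $ i $ j) * b j) = b i * x" for i
      using f_inv_into_f[of "b i * x" \<phi> UNIV] by (simp add: M_def \<phi>_def)
    have "\<phi> (v v* M x) = (\<Sum>j\<in>UNIV. \<Sum>i\<in>UNIV. to_ac (v $ i) * (to_ac (M x $ i $ j) * b j))"
      by (simp only: \<phi>_def vector_matrix_mult_def vec_lambda_beta to_ac_sum to_ac_mult sum_distrib_right mult.assoc)
    also have "\<dots> = (\<Sum>i\<in>UNIV. to_ac (v $ i) * (b i * x))"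
      by (subst sum.swap) (simp only: rows flip: sum_distrib_left)
    also have "\<dots> = \<phi> v * x"
      by (simp add: \<phi>_def sum_distrib_right mult.assoc)
    finally show ?thesis .
  qed
  \<comment> \<open>Agreement on one nonzero vector becomes
    \<open>\<phi> v * x = \<phi> v * y\<close>, and the nonzero \<open>\<phi> v\<close>
    cancels.\<close>
  have M_eq: "x = y" if "x \<in> ?K" "y \<in> ?K" "v \<noteq> 0" "v v* M x = v v* M y" for x y v
  proof -
    have "\<phi> v * x = \<phi> v * y"
      by (simp only: that(4) flip: \<phi>_M[OF that(1)] \<phi>_M[OF that(2)])
    moreover have "\<phi> v \<noteq> 0"
      using that(3) \<phi>_eq[of v 0] \<phi>_0 by simp
    ultimately show ?thesis by simp
  qed
  have "axis i 1 \<noteq> (0 :: 'a ^ 'n)" for i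
    by (simp add: axis_eq_0_iff)
  then have inj: "inj_on M ?K"
    by (intro inj_onI) (metis M_eq)
  have "0 \<in> ?K"
    by (rule ac.subspace_0[OF subspace_galois_subfield])
  show thesis
  proof
    \<comment> \<open>Multiplication by zero is singular, so zero is removed; this accounts for the
      \<open>- 1\<close> in the cardinality.\<close>
    show "M ` (?K - {0}) \<subseteq> GL"
    proof
      fix A assume "A \<in> M ` (?K - {0})"
      then obtain x where x: "x \<in> ?K" "x \<noteq> 0" "A = M x" by blast
      show "A \<in> GL"
        unfolding GL_def mem_Collect_eq
      proof (rule invertible_if_trivial_left_kernel)
        fix v assume "v v* A = 0"
        then have "\<phi> v * x = 0"
          using \<phi>_M[OF x(1), of v] by (simp add: x(3) \<phi>_0)
        then show "v = 0"
          using x(2) \<phi>_eq[of v 0] by (simp add: \<phi>_0)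
      qed
    qed
    have "card (M ` (?K - {0})) = card (?K - {0})"
      using inj by (intro card_image) (auto intro: inj_on_subset)
    also have "\<dots> = CARD('a) ^ CARD('n) - 1"
      using \<open>0 \<in> ?K\<close> by (simp add: card_Diff_singleton card_galois_subfield)
    finally show "card (M ` (?K - {0})) = CARD('a) ^ CARD('n) - 1" .
  qed (use M_eq in blast)
qed

section \<open>The product map and the final bound\<close>

lemma card_mult_le_card_GL:
  fixes \<F> S :: "('a::{field,finite} ^ 'n ^ 'n) set"
  assumes "\<F> \<subseteq> GL" "intersecting \<F>" "S \<subseteq> GL"
    and S: "\<And>A B v. A \<in> S \<Longrightarrow> B \<in> S \<Longrightarrow> v \<noteq> 0 \<Longrightarrow> v v* A = v v* B \<Longrightarrow> A = B"
  shows "card \<F> * card S \<le> card (GL :: ('a ^ 'n ^ 'n) set)"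
proof -
  have "inj_on (\<lambda>(T, A). T ** A) (\<F> \<times> S)"
  proof (rule inj_onI, clarsimp)
    fix T A T' A' assume T: "T \<in> \<F>" "T' \<in> \<F>" and A: "A \<in> S" "A' \<in> S" and eq: "T ** A = T' ** A'"
    obtain v where v: "v \<noteq> 0" "v v* T = v v* T'"
      using \<open>intersecting \<F>\<close> T unfolding intersecting_def by blast
    obtain R where R: "T ** R = mat 1"
      using \<open>\<F> \<subseteq> GL\<close> T(1) by (auto simp: GL_def invertible_def)
    \<comment> \<open>The image \<open>v v* T\<close> is the nonzero vector on which
      \<open>A\<close> and \<open>A'\<close> agree, as the hypothesis on \<open>S\<close>
      requires.\<close>
    have "v v* T \<noteq> 0"
      using v(1) R vector_matrix_mul_assoc[of v T R] by auto
    moreover have "(v v* T) v* A = (v v* T) v* A'"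
      by (metis eq v(2) vector_matrix_mul_assoc)
    ultimately have "A = A'"
      using S A by blast
    obtain Q where "A ** Q = mat 1"
      using \<open>S \<subseteq> GL\<close> A(1) by (auto simp: GL_def invertible_def)
    then have "T = T'"
      using eq \<open>A = A'\<close> by (metis matrix_mul_assoc matrix_mul_rid)
    with \<open>A = A'\<close> show "T = T' \<and> A = A'" by simp
  qed
  moreover have "(\<lambda>(T, A). T ** A) ` (\<F> \<times> S) \<subseteq> GL"
    using assms(1,3) by (auto simp: GL_def intro!: invertible_mult)
  ultimately have "card (\<F> \<times> S) \<le> card (GL :: ('a ^ 'n ^ 'n) set)"
    by (intro card_inj_on_le) auto
  then show ?thesis by (simp add: card_cartesian_product)
qed

text \<open>Pulling \<open>q ^ i\<close> out of each factor produces the power of \<open>q\<close>.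
  The factor \<open>q ^ n - 1\<close> is split off to cancel against the number of multiplication
  matrices.\<close>

lemma prod_power_diff:
  fixes q n :: nat
  assumes "n \<ge> 1"
  shows "(\<Prod>i<n. q ^ n - q ^ i) = q ^ ((n - 1) * n div 2) * (\<Prod>i = 1..n - 1. q ^ i - 1) * (q ^ n - 1)"
proof -
  have "(\<Prod>i<n. q ^ n - q ^ i) = (\<Prod>i<n. q ^ i * (q ^ (n - i) - 1))"
    by (intro prod.cong) (auto simp: diff_mult_distrib2 simp flip: power_add)
  also have "\<dots> = q ^ (\<Sum>i<n. i) * (\<Prod>i<n. q ^ (n - i) - 1)"
    by (simp add: prod.distrib power_sum)
  also have "(\<Sum>i<n. i) = (n - 1) * n div 2"
    using Sum_Ico_nat[of 0 n] by (simp add: lessThan_atLeast0 mult.commute)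
  also have "(\<Prod>i<n. q ^ (n - i) - 1) = (\<Prod>i = 1..n. q ^ i - 1)"
    by (rule prod.reindex_bij_witness[of _ "\<lambda>i. n - i" "\<lambda>i. n - i"]) auto
  also have "\<dots> = (\<Prod>i = 1..n - 1. q ^ i - 1) * (q ^ n - 1)"
    using assms by (cases n) simp_all
  finally show ?thesis by simp
qed

theorem theorem2:
  fixes \<F> :: "('a::{field, finite} ^ 'n ^ 'n) set" and n q :: nat
  assumes "n = CARD('n)" and "n \<ge> 1" and "q = CARD('a)"
    and "\<F> \<subseteq> GL" and "intersecting \<F>"
  shows "card \<F> \<le> q ^ ((n - 1) * n div 2) * (\<Prod>i = 1..n - 1. (q ^ i - 1))"
proof -
  obtain S :: "('a ^ 'n ^ 'n) set" where S: "S \<subseteq> GL" "card S = q ^ n - 1"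
    "\<And>A B v. A \<in> S \<Longrightarrow> B \<in> S \<Longrightarrow> v \<noteq> 0 \<Longrightarrow> v v* A = v v* B \<Longrightarrow> A = B"
    using exists_semiregular_matrices assms(1,3) by metis
  have "card \<F> * (q ^ n - 1) \<le> card (GL :: ('a ^ 'n ^ 'n) set)"
    using card_mult_le_card_GL[OF assms(4,5) S(1,3)] by (simp add: S(2))
  also have "\<dots> \<le> (\<Prod>i<n. q ^ n - q ^ i)"
    using card_GL_le assms(1,3) by blast
  also have "\<dots> = q ^ ((n - 1) * n div 2) * (\<Prod>i = 1..n - 1. q ^ i - 1) * (q ^ n - 1)"
    using assms(2) by (rule prod_power_diff)
  finally have "card \<F> * (q ^ n - 1)
      \<le> q ^ ((n - 1) * n div 2) * (\<Prod>i = 1..n - 1. q ^ i - 1) * (q ^ n - 1)" .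
  moreover have "2 \<le> q"
    using card_mono[of UNIV "{0, 1 :: 'a}"] by (simp add: assms(3))
  \<comment> \<open>Strictness makes the common factor \<open>q ^ n - 1\<close> positive, so it can
    be cancelled.\<close>
  then have "1 < q ^ n"
    using assms(2) by (intro one_less_power) auto
  ultimately show ?thesis
    by simp
qed

end
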